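(* Let $q$ be a prime power with $q\equiv 1 \pmod 6$. Then the covering radius of $\mathrm{PGL}_2(q)$, viewed as a subset of the symmetric group on the $q+1$ points of the projective line $\mathbb{F}_q\cup\{\infty\}$, equals $q-3$.
   Context: For $n\geq 2$, the Hamming distance on the symmetric group $S_n$ is $d(g,h)=n-|\mathrm{fix}(gh^{-1})|$, where $\mathrm{fix}$ denotes the set of fixed points. For a subset $C\subseteq S_n$ and $v\in S_n$, $d(v,C)=\min\{d(v,c)\mid c\in C\}$, and the covering radius of $C$ is $\max\{d(v,C)\mid v\in S_n\}$. The group $\mathrm{PGL}_2(q)$ acts faithfully on $\mathbb{F}_q\cup\{\infty\}$ by linear fractional transformations $x\mapsto (ax+b)/(cx+d)$, $ad-bc\neq 0$, and is thereby regarded as a subgroup of $S_{q+1}$. *)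

theory Defs
  imports "HOL-Number_Theory.Prime_Powers" "HOL-Number_Theory.Cong"
    "HOL-Combinatorics.Permutations" "HOL-Library.Cardinality"
begin

definition symmetric_group :: "('b::finite \<Rightarrow> 'b) set" where
  "symmetric_group = {p. p permutes UNIV}"

definition fixpoints :: "('b \<Rightarrow> 'b) \<Rightarrow> 'b set" where
  "fixpoints p = {x. p x = x}"

definition hamming_dist :: "('b::finite \<Rightarrow> 'b) \<Rightarrow> ('b \<Rightarrow> 'b) \<Rightarrow> nat" where
  "hamming_dist g h = CARD('b) - card (fixpoints (g \<circ> inv h))"

(* Min and Max below range over finite sets because the point type is finite;
   Min is meaningful for nonempty C only. *)

definition hamming_setdist :: "('b::finite \<Rightarrow> 'b) \<Rightarrow> ('b \<Rightarrow> 'b) set \<Rightarrow> nat" where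
  "hamming_setdist v C = Min {hamming_dist v c | c. c \<in> C}"

definition covering_radius :: "('b::finite \<Rightarrow> 'b) set \<Rightarrow> nat" where
  "covering_radius C = Max {hamming_setdist v C | v. v \<in> symmetric_group}"

(* The projective line over the field 'a is the type 'a option, with None as the
   point at infinity. *)

fun lin_frac :: "'a::field \<Rightarrow> 'a \<Rightarrow> 'a \<Rightarrow> 'a \<Rightarrow> 'a option \<Rightarrow> 'a option" where
  "lin_frac a b c d None = (if c = 0 then None else Some (a / c))"
| "lin_frac a b c d (Some x) =
     (if c * x + d = 0 then None else Some ((a * x + b) / (c * x + d)))"

definition PGL2 :: "('a::{field,finite} option \<Rightarrow> 'a option) set" where
  "PGL2 = {lin_frac a b c d | a b c d. a * d - b * c \<noteq> 0}"

lemma inj_lin_frac: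
  fixes a b c d :: "'a::field"
  assumes det: "a * d - b * c \<noteq> 0"
  shows "inj (lin_frac a b c d)"
proof (rule injI)
  fix u v assume eq: "lin_frac a b c d u = lin_frac a b c d v"
  have inf: False if "c \<noteq> 0" "c * x + d \<noteq> 0" "a / c = (a * x + b) / (c * x + d)" for x
  proof -
    have "a * (c * x + d) = (a * x + b) * c"
      using that by (simp add: frac_eq_eq)
    then show False using det by (simp add: algebra_simps)
  qed
  have zero: "x = y" if "c * x + d = 0" "c * y + d = 0" for x y
  proof -
    have "c \<noteq> 0" using det that by auto
    moreover have "c * x = c * y" using that by (metis add_right_cancel)
    ultimately show ?thesis by simp
  qed
  have fin: "x = y" if "c * x + d \<noteq> 0" "c * y + d \<noteq> 0"
    "(a * x + b) / (c * x + d) = (a * y + b) / (c * y + d)" for x y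
  proof -
    have "(a * x + b) * (c * y + d) = (a * y + b) * (c * x + d)"
      using that by (simp add: frac_eq_eq)
    then have "(a * d - b * c) * (x - y) = 0" by (simp add: algebra_simps)
    then show ?thesis using det by simp
  qed
  have None_Some: False if "lin_frac a b c d None = lin_frac a b c d (Some x)" for x
    using that det inf[of x] by (simp split: if_splits)
  have Some_Some: "x = y" if "lin_frac a b c d (Some x) = lin_frac a b c d (Some y)" for x y
    using that zero[of x y] fin[of x y] by (simp split: if_splits)
  show "u = v"
  proof (cases u)
    case None
    then show ?thesis using eq None_Some by (cases v) blast+
  next
    case (Some x)
    show ?thesis
    proof (cases v)
      case None
      then show ?thesis using eq Some None_Some[of x] by metis
    next
      case (Some y)
      then show ?thesis using eq \<open>u = Some x\<close> Some_Some[of x y] by metis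
    qed
  qed
qed

lemma PGL2_subset_symmetric_group: "PGL2 \<subseteq> symmetric_group"
proof
  fix g :: "'a option \<Rightarrow> 'a option" assume "g \<in> PGL2"
  then have "inj g" unfolding PGL2_def using inj_lin_frac by blast
  then have "bij g" by (simp add: bij_def finite_UNIV_inj_surj)
  then show "g \<in> symmetric_group"
    unfolding symmetric_group_def by (auto intro: bij_imp_permutes)
qed

end

theory Submission
  imports Defs "HOL-Computational_Algebra.Polynomial"
begin

text \<open>
  A permutation and a linear fractional map are at distance $q + 1 - k$ if they agree in $k$
  points, so the claim is that every permutation agrees with some linear fractional map in four
  points and that some permutation never agrees in more.

  Upper bound: after composition with an element of PGL2 the permutation fixes $\infty$ and $0$.
  If no map $x \mapsto a x$ agreed with it at two nonzero points, the quotients $v(x)/x$ would run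
  through all nonzero elements, so their product would be $-1$ by Wilson's theorem; but it is $1$.

  Lower bound: cubing is a bijection of the group of order $q + 1$ of norm-one elements of
  $\mathbb{F}_{q^2}$, because $3$ does not divide $q + 1$. On the projective line it becomes the
  Redei function $(x^3 + 3 \delta x) / (3 x^2 + \delta)$ with $\delta$ a nonsquare, a permutation
  given by a rational function of degree $3$, which agrees with a map of degree $1$ in at most
  four points.
\<close>

section \<open>Agreement counts and finite field facts\<close>

lemma card_fixpoints_comp_inv:
  assumes "bij c"
  shows "card (fixpoints (v \<circ> inv c)) = card {x. v x = c x}"
proof -
  have "fixpoints (v \<circ> inv c) = c ` {x. v x = c x}"
    using assms unfolding fixpoints_def
    by (auto simp: image_iff bij_is_inj bij_is_surj inv_f_f surj_f_inv_f)
       (metis bij_is_surj surj_f_inv_f)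
  then show ?thesis
    using card_image[OF inj_on_subset[OF bij_is_inj[OF assms]]] by auto
qed

text \<open>The factors cancel in pairs \<open>x\<close>, \<open>i x\<close>. Besides Wilson's
  theorem this serves, with all factors -1, as a parity argument.\<close>

lemma prod_involution_eq_1:
  fixes f :: "'b \<Rightarrow> 'c::comm_monoid_mult"
  assumes "finite A" "\<And>x. x \<in> A \<Longrightarrow> i x \<in> A \<and> i (i x) = x \<and> i x \<noteq> x \<and> f x * f (i x) = 1"
  shows "prod f A = 1"
  using assms
proof (induction "card A" arbitrary: A rule: less_induct)
  case less
  show ?case
  proof (cases "A = {}")
    case False
    then obtain x where x: "x \<in> A" by blast
    let ?B = "A - {x, i x}"
    have ix: "i x \<in> A" "i x \<noteq> x" "i (i x) = x" "f x * f (i x) = 1" using less.prems x by auto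
    have "prod f ?B = 1"
    proof (rule less.hyps)
      show "card ?B < card A" using x less.prems by (intro psubset_card_mono) auto
      show "i y \<in> ?B \<and> i (i y) = y \<and> i y \<noteq> y \<and> f y * f (i y) = 1" if "y \<in> ?B" for y
        using less.prems(2)[of y] less.prems(2)[OF x] that by auto
    qed (use less.prems in auto)
    moreover have "prod f A = f x * (f (i x) * prod f ?B)"
      using less.prems(1) x ix
      by (simp add: prod.remove[of A x] prod.remove[of "A - {x}" "i x"] Diff_insert2[symmetric] insert_commute)
    ultimately show ?thesis using ix by simp
  qed simp
qed

text \<open>Wilson's theorem: only 1 and -1 are self-inverse, the other nonzero elements cancel with
  their inverses.\<close>

lemma prod_nonzero_finite_field:
  assumes "(2::'a::{field,finite}) \<noteq> 0"
  shows "(\<Prod>x\<in>UNIV - {0::'a}. x) = -1"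
proof -
  have neq: "(1::'a) \<noteq> -1" using assms by (metis one_add_one add.right_inverse)
  have "(\<Prod>x\<in>UNIV - {0, 1, -1::'a}. x) = 1"
  proof (rule prod_involution_eq_1[where i = inverse])
    fix x :: 'a assume x: "x \<in> UNIV - {0, 1, -1}"
    have "inverse x \<noteq> x"
    proof
      assume "inverse x = x"
      then have "x * x = 1" using x by (metis DiffD2 insertI1 right_inverse)
      then show False using x square_eq_1_iff[of x] by auto
    qed
    moreover have "inverse x \<noteq> 1" "inverse x \<noteq> -1"
      using x by (auto simp: inverse_eq_1_iff) (metis inverse_inverse_eq inverse_minus_eq inverse_1)
    ultimately show "inverse x \<in> UNIV - {0, 1, -1} \<and> inverse (inverse x) = x \<and> inverse x \<noteq> x
        \<and> x * inverse x = 1"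
      using x by auto
  qed simp
  moreover have "UNIV - {0::'a} = insert 1 (insert (-1) (UNIV - {0, 1, -1}))" by auto
  ultimately show ?thesis using neq by simp
qed

text \<open>Multiplication by \<open>x\<close> permutes the nonzero elements, so their product
  absorbs the power of \<open>x\<close>.\<close>

lemma power_card_minus_1_finite_field:
  fixes x :: "'a::{field,finite}"
  assumes "x \<noteq> 0"
  shows "x ^ (CARD('a) - 1) = 1"
proof -
  have "bij_betw ((*) x) (UNIV - {0}) (UNIV - {0})"
    by (rule bij_betwI[where g = "\<lambda>y. y / x"]) (use assms in auto)
  then have "(\<Prod>y\<in>UNIV - {0}. x * y) = (\<Prod>y\<in>UNIV - {0::'a}. y)"
    by (rule prod.reindex_bij_betw)
  then show ?thesis by (simp add: prod.distrib card_Diff_singleton)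
qed

text \<open>As 3 divides \<open>CARD('a) - 1\<close>, there is a primitive cube root of unity
  \<open>w\<close>; the discriminant of its equation is -3, whence
  \<open>s = 2 * w + 1\<close>.\<close>

lemma minus_3_square_finite_field:
  assumes "[CARD('a::{field,finite}) = 1] (mod 3)"
  obtains s :: "'a::{field,finite}" where "s\<^sup>2 = -3"
proof -
  define m where "m = (CARD('a) - 1) div 3"
  have two: "CARD('a) \<ge> 2" using card_mono[of UNIV "{0, 1::'a}"] by simp
  then have "3 dvd CARD('a) - 1"
    using assms by (simp add: cong_altdef_nat)
  then have m: "CARD('a) - 1 = 3 * m" by (simp add: m_def)
  then have "m > 0" using two by (cases m) auto
  \<comment> \<open>This polynomial has at most \<open>m\<close> roots among the
    \<open>3 * m\<close> nonzero elements, so some \<open>x ^ m\<close> is not 1.\<close>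
  let ?p = "monom 1 m - 1 :: 'a poly"
  have "?p \<noteq> 0"
  proof
    assume "?p = 0"
    then have "poly ?p 0 = 0" by simp
    then show False using \<open>m > 0\<close> by (simp add: poly_monom power_0_left)
  qed
  then have "card {x. poly ?p x = 0} \<le> degree ?p" by (rule card_poly_roots_bound)
  also have "\<dots> \<le> m" by (intro degree_diff_le) (auto simp: degree_monom_le)
  also have "\<dots> < card (UNIV - {0::'a})" using m \<open>m > 0\<close> by (simp add: card_Diff_singleton)
  finally have "\<not> UNIV - {0::'a} \<subseteq> {x. poly ?p x = 0}"
    by (meson card_mono finite linorder_not_le)
  then obtain x :: 'a where x: "x \<noteq> 0" "x ^ m \<noteq> 1" by (auto simp: poly_monom)
  define w where "w = x ^ m"
  have "w ^ 3 = 1"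
    using power_card_minus_1_finite_field[OF x(1)]
    unfolding m w_def power_mult[symmetric] mult.commute[of m] .
  then have "(w - 1) * (w\<^sup>2 + w + 1) = 0" by (simp add: algebra_simps power2_eq_square power3_eq_cube)
  then have "w\<^sup>2 + w + 1 = 0" using x by (simp add: w_def)
  moreover have "(2 * w + 1)\<^sup>2 = 4 * (w\<^sup>2 + w + 1) - 3" by (simp add: algebra_simps power2_eq_square)
  ultimately have "(2 * w + 1)\<^sup>2 = -3" by simp
  then show thesis by (rule that)
qed

text \<open>Squaring identifies 1 and -1, so on a finite field it cannot be onto.\<close>

lemma ex_nonsquare_finite_field:
  assumes "(2::'a::{field,finite}) \<noteq> 0"
  obtains d :: "'a::{field,finite}" where "\<And>x. x\<^sup>2 \<noteq> d"
proof -
  have "(1::'a) \<noteq> -1" using assms by (metis one_add_one add.right_inverse)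
  then have "\<not> inj (\<lambda>x::'a. x\<^sup>2)" by (metis injD power2_minus)
  then have "\<not> surj (\<lambda>x::'a. x\<^sup>2)"
    using finite_UNIV_surj_inj[of "\<lambda>x::'a. x\<^sup>2"] by auto
  then show thesis using that unfolding surj_def by metis
qed

lemma two_neq_0_odd_card:
  assumes "odd CARD('a::{field,finite})"
  shows "(2::'a) \<noteq> 0"
proof
  assume two: "(2::'a) = 0"
  \<comment> \<open>In characteristic 2 the translation by 1 is an involution without fixed points.\<close>
  have "(\<Prod>x\<in>(UNIV::'a set). -1 :: int) = 1"
    by (rule prod_involution_eq_1[where i = "\<lambda>x. x + 1"]) (use two in \<open>auto simp: add.assoc\<close>)
  then show False using assms by simp
qed

section \<open>Upper bound: four agreements for every permutation\<close>

lemma PGL2_bij: "c \<in> PGL2 \<Longrightarrow> bij c"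
  using PGL2_subset_symmetric_group permutes_bij unfolding symmetric_group_def by blast

lemma PGL2_two_transitive:
  fixes p r :: "'a::{field,finite} option"
  assumes "p \<noteq> r"
  obtains a b c d where "a * d - b * c \<noteq> 0" "lin_frac a b c d None = p"
    "lin_frac a b c d (Some 0) = r"
proof (cases p)
  case None
  then obtain s where "r = Some s" using assms by (cases r) auto
  \<comment> \<open>The maps used in the three cases are x + s, (t x + 1) / x and (t x + s) / (x +
    1).\<close>
  then show thesis using None that[of 1 1 s 0] by simp
next
  case p: (Some t)
  show thesis
  proof (cases r)
    case None
    then show thesis using p that[of t 0 1 1] by simp
  next
    case (Some s)
    then show thesis using p assms that[of t 1 s 1] by simp
  qed
qed

lemma lin_frac_scale:
  fixes e :: "'a::field"
  assumes "e \<noteq> 0"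
  shows "lin_frac a b c d (map_option ((*) e) x) = lin_frac (a * e) b (c * e) d x"
  using assms by (cases x) (auto simp: mult.assoc)

lemma ex_PGL2_agree_four:
  fixes v :: "'a::{field,finite} option \<Rightarrow> 'a option"
  assumes two: "(2::'a) \<noteq> 0" and v: "bij v"
  shows "\<exists>c\<in>PGL2. 4 \<le> card {x. v x = c x}"
proof -
  have "v None \<noteq> v (Some 0)" using v by (metis bij_is_inj injD option.distinct(1))
  then obtain a b c d :: 'a where h: "a * d - b * c \<noteq> 0" "lin_frac a b c d None = v None"
    "lin_frac a b c d (Some 0) = v (Some 0)"
    by (rule PGL2_two_transitive)
  let ?h = "lin_frac a b c d"
  have bh: "bij ?h" using h by (intro PGL2_bij) (auto simp: PGL2_def)
  define w where "w = inv ?h \<circ> v"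
  have bw: "bij w" unfolding w_def using bh v by (simp add: bij_comp bij_imp_bij_inv)
  have hw: "?h (w x) = v x" for x using bh by (simp add: w_def bij_is_surj surj_f_inv_f)
  have w0: "w None = None" "w (Some 0) = Some 0"
    using inv_f_eq[OF bij_is_inj[OF bh] h(2)] inv_f_eq[OF bij_is_inj[OF bh] h(3)]
    by (simp_all add: w_def)
  \<comment> \<open>\<open>the\<close> is harmless: \<open>w\<close> is injective and fixes
    infinity, so it sends finite points to finite points.\<close>
  define u where "u x = the (w (Some x))" for x
  have wu: "w (Some x) = Some (u x)" for x
  proof -
    have "w (Some x) \<noteq> w None" using bw by (metis bij_is_inj injD option.distinct(1))
    then show ?thesis using w0 by (auto simp: u_def)
  qed
  have iu: "inj u" by (rule injI) (metis bw bij_is_inj injD option.inject wu)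
  have u0: "u 0 = 0" using wu[of 0] w0 by simp
  have un: "u x \<noteq> 0" if "x \<noteq> 0" for x using iu u0 that by (metis injD)
  have "bij u" using iu by (simp add: bij_def finite_UNIV_inj_surj)
  then have "bij_betw u (UNIV - {0}) (UNIV - {0})"
    using bij_betw_DiffI[of u UNIV UNIV "{0}" "{0}"] u0 by simp
  then have "prod u (UNIV - {0}) = (\<Prod>x\<in>UNIV - {0}. x)"
    using prod.reindex_bij_betw[of u _ _ "\<lambda>x. x"] by simp
  then have quot: "(\<Prod>x\<in>UNIV - {0}. u x / x) = 1"
    by (simp add: prod_dividef)
  have "\<not> inj_on (\<lambda>x. u x / x) (UNIV - {0})"
  proof
    assume inj: "inj_on (\<lambda>x. u x / x) (UNIV - {0})"
    have "u x / x \<in> UNIV - {0}" if "x \<in> UNIV - {0}" for x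
      using that un[of x] by simp
    then have "(\<lambda>x. u x / x) ` (UNIV - {0}) \<subseteq> UNIV - {0}" by (rule image_subsetI)
    then have "(\<lambda>x. u x / x) ` (UNIV - {0}) = UNIV - {0}"
      using inj by (rule endo_inj_surj[rotated]) simp
    then have "(\<Prod>x\<in>UNIV - {0}. u x / x) = (\<Prod>x\<in>UNIV - {0::'a}. x)"
      using prod.reindex[OF inj, of "\<lambda>x. x"] by (simp only: o_def)
    then have "(1::'a) = -1" unfolding quot prod_nonzero_finite_field[OF two] .
    then show False using two by (metis one_add_one add.right_inverse)
  qed
  then obtain x y where xy: "x \<noteq> 0" "y \<noteq> 0" "x \<noteq> y" "u x / x = u y / y"
    by (auto simp: inj_on_def)
  define e where "e = u x / x"
  then have "e = u y / y" using xy(4) by (rule trans)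
  then have "u y = e * y" using xy(2) by simp
  moreover have "e \<noteq> 0" "u x = e * x" using xy(1) un[of x] by (simp_all add: e_def)
  ultimately have e: "e \<noteq> 0" "u x = e * x" "u y = e * y" by blast+
  \<comment> \<open>\<open>w\<close> agrees with scaling by \<open>e\<close> at infinity, 0,
    \<open>x\<close> and \<open>y\<close>; following both by \<open>?h\<close> turns them into
    \<open>v\<close> and \<open>?g\<close>.\<close>
  let ?g = "lin_frac (a * e) b (c * e) d"
  have "(a * e) * d - b * (c * e) = e * (a * d - b * c)" by (simp add: algebra_simps)
  then have "?g \<in> PGL2" using e h unfolding PGL2_def by force
  moreover have "v z = ?g z" if "w z = map_option ((*) e) z" for z
    using hw[of z] that lin_frac_scale[OF e(1), of a b c d z] by simp
  then have "{None, Some 0, Some x, Some y} \<subseteq> {z. v z = ?g z}"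
    using w0 e by (auto simp: wu)
  then have "card {None, Some 0, Some x, Some y} \<le> card {z. v z = ?g z}"
    by (rule card_mono[rotated]) simp
  then have "4 \<le> card {z. v z = ?g z}" using xy by simp
  ultimately show ?thesis by blast
qed

section \<open>Lower bound: the Redei function\<close>

lemma redei_denominator_nonzero:
  fixes \<delta> s :: "'a::field"
  assumes nonsq: "\<And>x. x\<^sup>2 \<noteq> \<delta>" and s: "s\<^sup>2 = -3"
  shows "3 * x\<^sup>2 + \<delta> \<noteq> 0"
proof
  assume "3 * x\<^sup>2 + \<delta> = 0"
  \<comment> \<open>Since -3 is a square, a zero of the denominator would make
    \<open>\<delta>\<close> a square.\<close>
  then have "(s * x)\<^sup>2 = \<delta>"
    by (simp add: power_mult_distrib s eq_neg_iff_add_eq_0 add.commute flip: minus_mult_left)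
       (metis add.commute add_eq_0_iff)
  then show False using nonsq by blast
qed

text \<open>With r a square root of \<open>\<delta>\<close>, numerator and denominator are the parts
  of (x + r)^3 without r and with r. Infinity corresponds to the norm-one element 1 and is
  fixed.\<close>

definition redei :: "'a::field \<Rightarrow> 'a option \<Rightarrow> 'a option" where
  "redei \<delta> = map_option (\<lambda>x. (x ^ 3 + 3 * \<delta> * x) / (3 * x\<^sup>2 + \<delta>))"

lemma inj_redei:
  fixes \<delta> s :: "'a::field"
  assumes nonsq: "\<And>x. x\<^sup>2 \<noteq> \<delta>" and s: "s\<^sup>2 = -3"
  shows "inj (redei \<delta>)"
  unfolding redei_def
proof (intro option.inj_map injI)
  fix x y :: 'a
  assume "(x ^ 3 + 3 * \<delta> * x) / (3 * x\<^sup>2 + \<delta>) = (y ^ 3 + 3 * \<delta> * y) / (3 * y\<^sup>2 + \<delta>)"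
  then have "(x ^ 3 + 3 * \<delta> * x) * (3 * y\<^sup>2 + \<delta>) = (y ^ 3 + 3 * \<delta> * y) * (3 * x\<^sup>2 + \<delta>)"
    using redei_denominator_nonzero[OF assms] by (simp add: frac_eq_eq)
  then have "(x - y) * (3 * (x * y - \<delta>)\<^sup>2 + \<delta> * (x - y)\<^sup>2) = 0" by algebra
  \<comment> \<open>Up to the factor \<open>(x - y)\<^sup>2\<close> this is the Redei denominator at
    \<open>(x * y - \<delta>) / (x - y)\<close>.\<close>
  moreover have "3 * (x * y - \<delta>)\<^sup>2 + \<delta> * (x - y)\<^sup>2 \<noteq> 0" if "x \<noteq> y"
  proof -
    have "3 * (x * y - \<delta>)\<^sup>2 + \<delta> * (x - y)\<^sup>2
        = (x - y)\<^sup>2 * (3 * ((x * y - \<delta>) / (x - y))\<^sup>2 + \<delta>)"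
      using that by (simp add: power_divide distrib_left mult.commute)
    then show ?thesis using that redei_denominator_nonzero[OF assms] by simp
  qed
  ultimately show "x = y" by (cases "x = y") simp_all
qed

text \<open>Finite agreements are roots of a quartic \<open>P\<close>. Agreement at infinity forces
  \<open>c = 0\<close>, which kills the leading coefficient and so costs a root.\<close>

lemma card_redei_agree_le:
  fixes \<delta> s :: "'a::{field,finite}"
  assumes two: "(2::'a) \<noteq> 0" and nonsq: "\<And>x. x\<^sup>2 \<noteq> \<delta>" and s: "s\<^sup>2 = -3" and g: "g \<in> PGL2"
  shows "card {x. redei \<delta> x = g x} \<le> 4"
proof -
  obtain a b c d where abcd: "g = lin_frac a b c d" "a * d - b * c \<noteq> 0"
    using g by (auto simp: PGL2_def)
  let ?A = "{x. redei \<delta> x = g x}"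
  \<comment> \<open>The difference of the two sides after clearing denominators.\<close>
  define P where "P = [:- (b * \<delta>), 3 * \<delta> * d - a * \<delta>, 3 * \<delta> * c - 3 * b, d - 3 * a, c:]"
  have delta: "\<delta> \<noteq> 0" using nonsq[of 0] by auto
  have "P \<noteq> 0"
  proof
    assume "P = 0"
    then have c: "c = 0" and d: "d = 3 * a" and "3 * \<delta> * d - a * \<delta> = 0"
      unfolding P_def pCons_eq_0_iff eq_iff_diff_eq_0[of d] by blast+
    \<comment> \<open>The linear coefficient becomes 8 times \<open>\<delta> * a\<close>, and 8 is
      nonzero because 2 is.\<close>
    then have "\<delta> * (3 * (3 * a) - a) = 0" by (simp only: d) algebra
    then have "3 * (3 * a) - a = 0" using delta by (metis mult_eq_0_iff)
    then have "2 * (2 * (2 * a)) = 0" by algebra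
    then have "a = 0" using two by (metis mult_eq_0_iff)
    then show False using abcd c by simp
  qed
  have sub: "?A \<subseteq> (if c = 0 then {None} else {}) \<union> Some ` {x. poly P x = 0}"
  proof
    fix z assume z: "z \<in> ?A"
    show "z \<in> (if c = 0 then {None} else {}) \<union> Some ` {x. poly P x = 0}"
    proof (cases z)
      case None
      then show ?thesis using z abcd by (simp add: redei_def split: if_splits)
    next
      case (Some x)
      then have "c * x + d \<noteq> 0"
        "(x ^ 3 + 3 * \<delta> * x) / (3 * x\<^sup>2 + \<delta>) = (a * x + b) / (c * x + d)"
        using z abcd by (auto simp: redei_def split: if_splits)
      then have "(x ^ 3 + 3 * \<delta> * x) * (c * x + d) = (a * x + b) * (3 * x\<^sup>2 + \<delta>)"
        using redei_denominator_nonzero[OF nonsq s] by (simp add: frac_eq_eq)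
      then have "poly P x = 0"
        by (simp add: P_def algebra_simps power2_eq_square power3_eq_cube)
      then show ?thesis using Some by simp
    qed
  qed
  have "degree P \<le> (if c = 0 then 3 else 4)" by (simp add: P_def)
  then have roots: "card (Some ` {x. poly P x = 0}) \<le> (if c = 0 then 3 else 4)"
    using card_poly_roots_bound[OF \<open>P \<noteq> 0\<close>] by (simp add: card_image)
  have "card ?A \<le> card ((if c = 0 then {None} else {}) \<union> Some ` {x. poly P x = 0})"
    by (rule card_mono[OF _ sub]) simp
  also have "\<dots> \<le> card (if c = 0 then {None :: 'a option} else {}) + card (Some ` {x. poly P x = 0})"
    by (rule card_Un_le)
  also have "\<dots> \<le> 4" using roots by (simp split: if_splits)
  finally show ?thesis .
qed

theorem theorem2:
  fixes q :: nat
  assumes "primepow q"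
    and "[q = 1] (mod 6)"
    and "CARD('a::{field,finite}) = q"
  shows "covering_radius (PGL2 :: ('a option \<Rightarrow> 'a option) set) = q - 3"
proof -
  let ?G = "PGL2 :: ('a option \<Rightarrow> 'a option) set"
  have "odd q" "[q = 1] (mod 3)"
    using assms(2) cong_dvd_modulus_nat[of q 1 6 2] cong_dvd_modulus_nat[of q 1 6 3]
    by (auto simp: cong_def odd_iff_mod_2_eq_one)
  then have two: "(2::'a) \<noteq> 0" and cong3: "[CARD('a) = 1] (mod 3)"
    using assms(3) two_neq_0_odd_card by auto
  obtain s :: 'a where s: "s\<^sup>2 = -3" by (rule minus_3_square_finite_field[OF cong3])
  obtain \<delta> :: 'a where nonsq: "\<And>x. x\<^sup>2 \<noteq> \<delta>" using ex_nonsquare_finite_field[OF two] by blast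
  \<comment> \<open>The projective line has \<open>q + 1\<close> points, so four agreements mean
    distance \<open>q - 3\<close>.\<close>
  have dist: "hamming_dist v c = q + 1 - card {x. v x = c x}" if "c \<in> ?G" for v c
    using card_fixpoints_comp_inv[OF PGL2_bij[OF that], of v] assms(3)
    by (simp add: hamming_dist_def card_UNIV_option)
  have le: "hamming_setdist v ?G \<le> q - 3" if v: "v \<in> symmetric_group" for v
  proof -
    have "bij v" using v by (auto simp: symmetric_group_def permutes_bij)
    then obtain c where c: "c \<in> ?G" "4 \<le> card {x. v x = c x}"
      using ex_PGL2_agree_four[OF two] by blast
    have "hamming_setdist v ?G \<le> hamming_dist v c"
      unfolding hamming_setdist_def using c by (intro Min_le) auto
    also have "\<dots> \<le> q - 3" using c dist by simp
    finally show ?thesis .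
  qed
  have "inj (redei \<delta>)" using nonsq s by (rule inj_redei)
  then have "bij (redei \<delta>)" by (simp add: bij_def finite_UNIV_inj_surj)
  then have R: "redei \<delta> \<in> symmetric_group"
    by (auto simp: symmetric_group_def intro: bij_imp_permutes)
  \<comment> \<open>The identity makes the group nonempty, so the minimum is attained.\<close>
  have "lin_frac 1 0 0 1 \<in> ?G" unfolding PGL2_def by force
  then have "hamming_setdist (redei \<delta>) ?G \<in> {hamming_dist (redei \<delta>) c | c. c \<in> ?G}"
    unfolding hamming_setdist_def by (intro Min_in) auto
  then obtain c where "c \<in> ?G" "hamming_setdist (redei \<delta>) ?G = hamming_dist (redei \<delta>) c" by blast
  then have "hamming_setdist (redei \<delta>) ?G \<ge> q - 3"
    using dist card_redei_agree_le[OF two nonsq s, of c] by simp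
  then have "hamming_setdist (redei \<delta>) ?G = q - 3" using le[OF R] by simp
  then show ?thesis
    unfolding covering_radius_def using le R by (intro Max_eqI) force+
qed

end
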